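(* Let $R$ be a finite rack, $V$ an (additive) abelian group, and $w\colon R\times R\to V$ a rack 2-cocycle. Let $G$ be any group structure on the underlying set of $R$, and consider the crossed module $(\partial\colon G\times V\to G,\bullet)$ with $\partial(g,v)=g$ and $g\bullet(h,v)=(ghg^{-1},v)$. Define $\psi,\phi\colon G\times G\to G\times V$ by $$\psi(B,A)=\big(B\,A\,B^{-1}(B\triangleright A)^{-1},\;w(B\triangleright A,B)\big),\qquad \phi(B,A)=\big(A\,B\,(A\triangleleft B)^{-1}B^{-1},\;-w(A,B)\big),$$ where $\triangleright,\triangleleft$ are the rack operations. Then $\Phi=(\psi,\phi)$ is a framed Reidemeister pair, and its associated framed link invariant $I_\Phi$ coincides with the usual rack cohomology (cocycle) invariant of framed links. Moreover, if $R$ is a quandle and $w$ is a quandle 2-cocycle, then $\Phi$ is an unframed Reidemeister pair and its associated invariant of links coincides with the usual quandle cocycle link invariant.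
   Context: A rack is a set $R$ with operations $\triangleright,\triangleleft$ such that for all $x,y,z$: $x\triangleright(y\triangleleft x)=y$; $(x\triangleright y)\triangleleft x=y$; $x\triangleright(y\triangleright z)=(x\triangleright y)\triangleright(x\triangleright z)$; $(x\triangleleft y)\triangleleft z=(x\triangleleft z)\triangleleft(y\triangleleft z)$. A quandle is a rack with $x\triangleleft x=x=x\triangleright x$. A rack 2-cocycle is a map $w\colon R\times R\to V$ with $w(x,y)+w(x\triangleleft y,z)=w(x,z)+w(x\triangleleft z,y\triangleleft z)$ for all $x,y,z$; if $R$ is a quandle, $w$ is a quandle 2-cocycle if moreover $w(x,x)=0$ for all $x$. For a crossed module $(\mu\colon P\to H,\cdot)$ (group morphism $\mu$ with left action of $H$ on $P$ by automorphisms, $\mu(g\cdot e)=g\mu(e)g^{-1}$, $\mu(e)\cdot f=efe^{-1}$), functions $\psi,\phi\colon H\times H\to P$ form an unframed Reidemeister pair if for all $X,Y,T\in H$: (R1) $\psi(X,X)=1$; (R2) $\phi(X,Y)\psi(X,Z)=1$, where $Z=X^{-1}\mu(\phi(X,Y))^{-1}YX$; (R3) $\phi(Y,X)(Y\cdot\phi(T,Z))\phi(T,Y)=(X\cdot\phi(T,Y))\phi(T,X)(T\cdot\phi(V',W'))$, where $Z=Y^{-1}\mu(\phi(Y,X))^{-1}XY$, $V'=T^{-1}\mu(\phi(T,Y))^{-1}YT$, $W'=T^{-1}\mu(\phi(T,X))^{-1}XT$. They form a framed Reidemeister pair if (R2), (R3) hold and for each $Z\in H$ the equation $\mu(\phi(A,Z))A=Z$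 has a unique solution $A=f(Z)$, and $f$ is the two-sided inverse of $g(A)=\mu(\psi(A,A))^{-1}A$. Link diagrams (blackboard framing for framed links) are drawn as sliced diagrams: horizontal strips, each containing vertical lines and at most one cup, cap, or crossing $X_+$ (positive) or $X_-$ (negative). In $X_+$ both strands point down, the over strand runs from top right to bottom left and the under strand from top left to bottom right. In $X_-$ both strands point down, the over strand runs from top left to bottom right and the under strand from top right to bottom left. Invariant $I_\Phi$ ($H$ finite): a Reidemeister colouring $F$ assigns elements of $H$ to arcs and elements of $P$ to crossings so that: at an $X_+$ with over arc $X$, bottom-right under arc $Y$, top-left under arc $Z$, the crossing carries $\psi(X,Y)$ and $Z=\mu(\psi(X,Y))^{-1}XYX^{-1}$; at an $X_-$ with over arc $X$, bottom-left under arc $Y$, top-right under arc $Z$, the crossing carries $\phi(X,Y)$ and $Z=X^{-1}\mu(\phi(X,Y))^{-1}YX$. The associated monoidal category has objects the elements of $H$, morphisms $U\xrightarrow{e}U_1$ with $e\in P$, $\mu(e)U=U_1$, composition $U\xrightarrow{e}U_1\xrightarrow{f}U_2=U\xrightarrow{fe}U_2$, and tensor product $(U\xrightarrow{e}U_1)\otimes(U'\xrightarrow{e'}U_1')=(UU'\xrightarrow{(U_1\cdot e')e}U_1U_1')$. The evaluation $e(F)$ is obtained by tensoring horizontally and composing vertically (top to bottom), where $X_+$ gives $ZX\xrightarrow{\psi(X,Y)}XY$, $X_-$ gives $XZ\xrightarrow{\phi(X,Y)}YX$, vertical strands coloured $X$ give identities of $X$ (downwards) or $X^{-1}$ (upwards),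 cups and caps give morphisms with element $1_P$. For a link diagram $e(F)\in\ker\mu$ and $I_\Phi(D)=\sum_Fe(F)\in\mathbb{Z}[\ker\mu]$; here $\ker\partial=\{1_G\}\times V\cong V$. Usual rack (quandle) cocycle invariant: $\sum_{c}\prod_{\tau}\,w_\tau(c)^{\epsilon(\tau)}\in\mathbb{Z}[V]$ ($V$ written multiplicatively inside the group ring), the sum over all rack colourings $c$ of the arcs of the diagram by $R$, the product over crossings $\tau$, $\epsilon(\tau)=\pm1$ the sign of $\tau$. Here in a rack colouring, at an $X_+$ with over arc $y$ and bottom-right under arc $x$ the top-left under arc is $y\triangleright x$, and the weight is $w_\tau=w(y\triangleright x,y)$; at an $X_-$ with over arc $y$ and bottom-left under arc $x$ the top-right under arc is $x\triangleleft y$, and the weight is $w_\tau=w(x,y)$. *)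

theory Defs
  imports "HOL-Algebra.Free_Abelian_Groups"
begin

section \<open>Racks, quandles and their cocycles\<close>

locale rack =
  fixes R :: "'a set"
    and rtri :: "'a \<Rightarrow> 'a \<Rightarrow> 'a" (infixl "\<triangleright>" 70)
    and ltri :: "'a \<Rightarrow> 'a \<Rightarrow> 'a" (infixl "\<triangleleft>" 70)
  assumes rtri_closed: "\<lbrakk>x \<in> R; y \<in> R\<rbrakk> \<Longrightarrow> x \<triangleright> y \<in> R"
    and ltri_closed: "\<lbrakk>x \<in> R; y \<in> R\<rbrakk> \<Longrightarrow> x \<triangleleft> y \<in> R"
    and rtri_ltri: "\<lbrakk>x \<in> R; y \<in> R\<rbrakk> \<Longrightarrow> x \<triangleright> (y \<triangleleft> x) = y"
    and ltri_rtri: "\<lbrakk>x \<in> R; y \<in> R\<rbrakk> \<Longrightarrow> (x \<triangleright> y) \<triangleleft> x = y"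
    and rtri_distrib: "\<lbrakk>x \<in> R; y \<in> R; z \<in> R\<rbrakk> \<Longrightarrow> x \<triangleright> (y \<triangleright> z) = (x \<triangleright> y) \<triangleright> (x \<triangleright> z)"
    and ltri_distrib: "\<lbrakk>x \<in> R; y \<in> R; z \<in> R\<rbrakk> \<Longrightarrow> (x \<triangleleft> y) \<triangleleft> z = (x \<triangleleft> z) \<triangleleft> (y \<triangleleft> z)"

locale quandle = rack +
  assumes ltri_idem: "x \<in> R \<Longrightarrow> x \<triangleleft> x = x"
    and rtri_idem: "x \<in> R \<Longrightarrow> x \<triangleright> x = x"

text \<open>The coefficient group \<open>V\<close> is a HOL-Algebra \<open>comm_group\<close>, hence written
  multiplicatively: \<open>\<otimes>\<close>, \<open>\<one>\<close> and \<open>inv\<close> of \<open>V\<close> are the \<open>+\<close>, \<open>0\<close> and \<open>-\<close> of the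
  additive notation.\<close>

definition rack_cocycle ::
  "'a set \<Rightarrow> ('a \<Rightarrow> 'a \<Rightarrow> 'a) \<Rightarrow> ('v, 'n) monoid_scheme \<Rightarrow> ('a \<Rightarrow> 'a \<Rightarrow> 'v) \<Rightarrow> bool" where
  "rack_cocycle R ltri V w \<longleftrightarrow>
     w \<in> R \<rightarrow> R \<rightarrow> carrier V \<and>
     (\<forall>x\<in>R. \<forall>y\<in>R. \<forall>z\<in>R.
        w x y \<otimes>\<^bsub>V\<^esub> w (ltri x y) z = w x z \<otimes>\<^bsub>V\<^esub> w (ltri x z) (ltri y z))"

definition quandle_cocycle ::
  "'a set \<Rightarrow> ('a \<Rightarrow> 'a \<Rightarrow> 'a) \<Rightarrow> ('v, 'n) monoid_scheme \<Rightarrow> ('a \<Rightarrow> 'a \<Rightarrow> 'v) \<Rightarrow> bool" where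
  "quandle_cocycle R ltri V w \<longleftrightarrow>
     rack_cocycle R ltri V w \<and> (\<forall>x\<in>R. w x x = \<one>\<^bsub>V\<^esub>)"


section \<open>Crossed modules and Reidemeister pairs\<close>

text \<open>By \<open>act_one\<close> and \<open>act_mult\<close> each endomorphism \<open>act g\<close> is an automorphism of \<open>P\<close>.\<close>

locale crossed_module = P: group P + H: group H
  for P :: "('p, 'm) monoid_scheme" and H :: "('h, 'n) monoid_scheme" +
  fixes \<mu> :: "'p \<Rightarrow> 'h" and act :: "'h \<Rightarrow> 'p \<Rightarrow> 'p"
  assumes mu_hom: "\<mu> \<in> hom P H"
    and act_hom: "g \<in> carrier H \<Longrightarrow> act g \<in> hom P P"
    and act_one: "e \<in> carrier P \<Longrightarrow> act \<one>\<^bsub>H\<^esub> e = e"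
    and act_mult: "\<lbrakk>g \<in> carrier H; h \<in> carrier H; e \<in> carrier P\<rbrakk> \<Longrightarrow>
          act (g \<otimes>\<^bsub>H\<^esub> h) e = act g (act h e)"
    and equivariance: "\<lbrakk>g \<in> carrier H; e \<in> carrier P\<rbrakk> \<Longrightarrow>
          \<mu> (act g e) = g \<otimes>\<^bsub>H\<^esub> \<mu> e \<otimes>\<^bsub>H\<^esub> inv\<^bsub>H\<^esub> g"
    and peiffer: "\<lbrakk>e \<in> carrier P; f \<in> carrier P\<rbrakk> \<Longrightarrow>
          act (\<mu> e) f = e \<otimes>\<^bsub>P\<^esub> f \<otimes>\<^bsub>P\<^esub> inv\<^bsub>P\<^esub> e"

text \<open>The colour of the upper under arc forced by the over arc \<open>X\<close> and the lower under arc \<open>Y\<close>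
  at a positive, respectively negative, crossing.\<close>

definition pos_under ::
  "('h, 'n) monoid_scheme \<Rightarrow> ('p \<Rightarrow> 'h) \<Rightarrow> ('h \<Rightarrow> 'h \<Rightarrow> 'p) \<Rightarrow> 'h \<Rightarrow> 'h \<Rightarrow> 'h" where
  "pos_under H \<mu> \<psi> X Y = inv\<^bsub>H\<^esub> (\<mu> (\<psi> X Y)) \<otimes>\<^bsub>H\<^esub> X \<otimes>\<^bsub>H\<^esub> Y \<otimes>\<^bsub>H\<^esub> inv\<^bsub>H\<^esub> X"

definition neg_under ::
  "('h, 'n) monoid_scheme \<Rightarrow> ('p \<Rightarrow> 'h) \<Rightarrow> ('h \<Rightarrow> 'h \<Rightarrow> 'p) \<Rightarrow> 'h \<Rightarrow> 'h \<Rightarrow> 'h" where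
  "neg_under H \<mu> \<phi> X Y = inv\<^bsub>H\<^esub> X \<otimes>\<^bsub>H\<^esub> inv\<^bsub>H\<^esub> (\<mu> (\<phi> X Y)) \<otimes>\<^bsub>H\<^esub> Y \<otimes>\<^bsub>H\<^esub> X"

definition reidemeister1 ::
  "('p, 'm) monoid_scheme \<Rightarrow> ('h, 'n) monoid_scheme \<Rightarrow> ('h \<Rightarrow> 'h \<Rightarrow> 'p) \<Rightarrow> bool" where
  "reidemeister1 P H \<psi> \<longleftrightarrow> (\<forall>X\<in>carrier H. \<psi> X X = \<one>\<^bsub>P\<^esub>)"

definition reidemeister2 ::
  "('p, 'm) monoid_scheme \<Rightarrow> ('h, 'n) monoid_scheme \<Rightarrow> ('p \<Rightarrow> 'h) \<Rightarrow>
   ('h \<Rightarrow> 'h \<Rightarrow> 'p) \<Rightarrow> ('h \<Rightarrow> 'h \<Rightarrow> 'p) \<Rightarrow> bool" where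
  "reidemeister2 P H \<mu> \<psi> \<phi> \<longleftrightarrow>
     (\<forall>X\<in>carrier H. \<forall>Y\<in>carrier H. \<phi> X Y \<otimes>\<^bsub>P\<^esub> \<psi> X (neg_under H \<mu> \<phi> X Y) = \<one>\<^bsub>P\<^esub>)"

definition reidemeister3 ::
  "('p, 'm) monoid_scheme \<Rightarrow> ('h, 'n) monoid_scheme \<Rightarrow> ('p \<Rightarrow> 'h) \<Rightarrow> ('h \<Rightarrow> 'p \<Rightarrow> 'p) \<Rightarrow>
   ('h \<Rightarrow> 'h \<Rightarrow> 'p) \<Rightarrow> bool" where
  "reidemeister3 P H \<mu> act \<phi> \<longleftrightarrow>
     (\<forall>X\<in>carrier H. \<forall>Y\<in>carrier H. \<forall>T\<in>carrier H.
        let Z = neg_under H \<mu> \<phi> Y X;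
            V' = neg_under H \<mu> \<phi> T Y;
            W' = neg_under H \<mu> \<phi> T X
        in \<phi> Y X \<otimes>\<^bsub>P\<^esub> act Y (\<phi> T Z) \<otimes>\<^bsub>P\<^esub> \<phi> T Y
           = act X (\<phi> T Y) \<otimes>\<^bsub>P\<^esub> \<phi> T X \<otimes>\<^bsub>P\<^esub> act T (\<phi> V' W'))"

definition unframed_reidemeister_pair ::
  "('p, 'm) monoid_scheme \<Rightarrow> ('h, 'n) monoid_scheme \<Rightarrow> ('p \<Rightarrow> 'h) \<Rightarrow> ('h \<Rightarrow> 'p \<Rightarrow> 'p) \<Rightarrow>
   ('h \<Rightarrow> 'h \<Rightarrow> 'p) \<Rightarrow> ('h \<Rightarrow> 'h \<Rightarrow> 'p) \<Rightarrow> bool" where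
  "unframed_reidemeister_pair P H \<mu> act \<psi> \<phi> \<longleftrightarrow>
     \<psi> \<in> carrier H \<rightarrow> carrier H \<rightarrow> carrier P \<and> \<phi> \<in> carrier H \<rightarrow> carrier H \<rightarrow> carrier P \<and>
     reidemeister1 P H \<psi> \<and> reidemeister2 P H \<mu> \<psi> \<phi> \<and> reidemeister3 P H \<mu> act \<phi>"

definition framed_reidemeister_pair ::
  "('p, 'm) monoid_scheme \<Rightarrow> ('h, 'n) monoid_scheme \<Rightarrow> ('p \<Rightarrow> 'h) \<Rightarrow> ('h \<Rightarrow> 'p \<Rightarrow> 'p) \<Rightarrow>
   ('h \<Rightarrow> 'h \<Rightarrow> 'p) \<Rightarrow> ('h \<Rightarrow> 'h \<Rightarrow> 'p) \<Rightarrow> bool" where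
  "framed_reidemeister_pair P H \<mu> act \<psi> \<phi> \<longleftrightarrow>
     \<psi> \<in> carrier H \<rightarrow> carrier H \<rightarrow> carrier P \<and> \<phi> \<in> carrier H \<rightarrow> carrier H \<rightarrow> carrier P \<and>
     reidemeister2 P H \<mu> \<psi> \<phi> \<and> reidemeister3 P H \<mu> act \<phi> \<and>
     (\<forall>Z\<in>carrier H. \<exists>!A. A \<in> carrier H \<and> \<mu> (\<phi> A Z) \<otimes>\<^bsub>H\<^esub> A = Z) \<and>
     (let f = (\<lambda>Z. THE A. A \<in> carrier H \<and> \<mu> (\<phi> A Z) \<otimes>\<^bsub>H\<^esub> A = Z);
          g = (\<lambda>A. inv\<^bsub>H\<^esub> (\<mu> (\<psi> A A)) \<otimes>\<^bsub>H\<^esub> A)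
      in (\<forall>A\<in>carrier H. f (g A) = A) \<and> (\<forall>Z\<in>carrier H. g (f Z) = Z))"


section \<open>Sliced link diagrams\<close>

datatype dir = Down | Up

fun flip :: "dir \<Rightarrow> dir" where
  "flip Down = Up"
| "flip Up = Down"

text \<open>A cap is a local maximum (two ends at the bottom), a cup a local minimum (two ends at the
  top); the argument is the direction of the left one of these two ends. \<open>Blank\<close> is used for
  strips that only contain vertical lines.\<close>

datatype piece = Blank | PosX | NegX | Cap dir | Cup dir

fun piece_top :: "piece \<Rightarrow> dir list" where
  "piece_top Blank = []"
| "piece_top PosX = [Down, Down]"
| "piece_top NegX = [Down, Down]"
| "piece_top (Cap d) = []"
| "piece_top (Cup d) = [d, flip d]"

fun piece_bot :: "piece \<Rightarrow> dir list" where
  "piece_bot Blank = []"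
| "piece_bot PosX = [Down, Down]"
| "piece_bot NegX = [Down, Down]"
| "piece_bot (Cap d) = [d, flip d]"
| "piece_bot (Cup d) = []"

text \<open>A strip consists of vertical lines, a piece, and further vertical lines, from left to right.
  A diagram is the list of its strips from top to bottom.\<close>

datatype slice = Slice (lefts: "dir list") (piece_of: piece) (rights: "dir list")

definition slice_top :: "slice \<Rightarrow> dir list" where
  "slice_top s = lefts s @ piece_top (piece_of s) @ rights s"

definition slice_bot :: "slice \<Rightarrow> dir list" where
  "slice_bot s = lefts s @ piece_bot (piece_of s) @ rights s"

fun tangle_diagram :: "dir list \<Rightarrow> slice list \<Rightarrow> dir list \<Rightarrow> bool" where
  "tangle_diagram u [] v \<longleftrightarrow> u = v"
| "tangle_diagram u (s # D) v \<longleftrightarrow> slice_top s = u \<and> tangle_diagram (slice_bot s) D v"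

definition link_diagram :: "slice list \<Rightarrow> bool" where
  "link_diagram D \<longleftrightarrow> tangle_diagram [] D []"

definition crossings :: "slice list \<Rightarrow> nat set" where
  "crossings D = {i. i < length D \<and> piece_of (D ! i) \<in> {PosX, NegX}}"

text \<open>\<open>(i, j)\<close> is the \<open>j\<close>-th point, from the left, in which the link meets the horizontal line at
  the top of strip \<open>i\<close>, i.e. at the bottom of strip \<open>i - 1\<close>. The line at the very bottom
  of a link diagram is not met.\<close>

definition points :: "slice list \<Rightarrow> (nat \<times> nat) set" where
  "points D = {(i, j). i < length D \<and> j < length (slice_top (D ! i))}"

text \<open>\<open>joined D p q\<close>: the points \<open>p\<close> and \<open>q\<close> are joined inside one strip by a vertical line,
  a cap, a cup, or the over strand of a crossing. The under strand is cut at the crossing.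
  The arcs are the classes of the equivalence relation generated by \<open>joined D\<close>.\<close>

inductive joined :: "slice list \<Rightarrow> nat \<times> nat \<Rightarrow> nat \<times> nat \<Rightarrow> bool" for D where
  left: "\<lbrakk>i < length D; D ! i = Slice l p r; j < length l\<rbrakk> \<Longrightarrow> joined D (i, j) (Suc i, j)"
| right: "\<lbrakk>i < length D; D ! i = Slice l p r; j < length r\<rbrakk> \<Longrightarrow>
     joined D (i, length l + length (piece_top p) + j) (Suc i, length l + length (piece_bot p) + j)"
| over_pos: "\<lbrakk>i < length D; D ! i = Slice l PosX r\<rbrakk> \<Longrightarrow>
     joined D (i, Suc (length l)) (Suc i, length l)"
| over_neg: "\<lbrakk>i < length D; D ! i = Slice l NegX r\<rbrakk> \<Longrightarrow>
     joined D (i, length l) (Suc i, Suc (length l))"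
| cap: "\<lbrakk>i < length D; D ! i = Slice l (Cap d) r\<rbrakk> \<Longrightarrow>
     joined D (Suc i, length l) (Suc i, Suc (length l))"
| cup: "\<lbrakk>i < length D; D ! i = Slice l (Cup d) r\<rbrakk> \<Longrightarrow>
     joined D (i, length l) (i, Suc (length l))"

definition arc_of :: "slice list \<Rightarrow> nat \<times> nat \<Rightarrow> (nat \<times> nat) set" where
  "arc_of D p = {q. equivclp (joined D) p q}"

definition arcs :: "slice list \<Rightarrow> (nat \<times> nat) set set" where
  "arcs D = arc_of D ` points D"

text \<open>At a crossing in strip \<open>i\<close>: in \<open>PosX\<close> the over strand runs from top right to bottom left
  and the under strand from top left to bottom right; in \<open>NegX\<close> it is the other way round.\<close>

definition over_arc :: "slice list \<Rightarrow> nat \<Rightarrow> (nat \<times> nat) set" where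
  "over_arc D i = (let m = length (lefts (D ! i)) in
     if piece_of (D ! i) = PosX then arc_of D (i, Suc m) else arc_of D (i, m))"

definition upper_under_arc :: "slice list \<Rightarrow> nat \<Rightarrow> (nat \<times> nat) set" where
  "upper_under_arc D i = (let m = length (lefts (D ! i)) in
     if piece_of (D ! i) = PosX then arc_of D (i, m) else arc_of D (i, Suc m))"

definition lower_under_arc :: "slice list \<Rightarrow> nat \<Rightarrow> (nat \<times> nat) set" where
  "lower_under_arc D i = (let m = length (lefts (D ! i)) in
     if piece_of (D ! i) = PosX then arc_of D (Suc i, Suc m) else arc_of D (Suc i, m))"

definition crossing_sign :: "slice list \<Rightarrow> nat \<Rightarrow> int" where
  "crossing_sign D i = (if piece_of (D ! i) = PosX then 1 else - 1)"


section \<open>The invariant of a Reidemeister pair\<close>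

text \<open>A colouring consists of a colouring \<open>c\<close> of the arcs and a colouring \<open>d\<close> of the crossings.
  Colourings are extensional, so that they are counted without repetition.\<close>

definition reidemeister_colourings ::
  "('p, 'm) monoid_scheme \<Rightarrow> ('h, 'n) monoid_scheme \<Rightarrow> ('p \<Rightarrow> 'h) \<Rightarrow>
   ('h \<Rightarrow> 'h \<Rightarrow> 'p) \<Rightarrow> ('h \<Rightarrow> 'h \<Rightarrow> 'p) \<Rightarrow> slice list \<Rightarrow>
   (((nat \<times> nat) set \<Rightarrow> 'h) \<times> (nat \<Rightarrow> 'p)) set" where
  "reidemeister_colourings P H \<mu> \<psi> \<phi> D =
     {(c, d). c \<in> arcs D \<rightarrow>\<^sub>E carrier H \<and> d \<in> crossings D \<rightarrow>\<^sub>E carrier P \<and>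
        (\<forall>i\<in>crossings D.
           let X = c (over_arc D i); Y = c (lower_under_arc D i); Z = c (upper_under_arc D i)
           in (piece_of (D ! i) = PosX \<longrightarrow> d i = \<psi> X Y \<and> Z = pos_under H \<mu> \<psi> X Y) \<and>
              (piece_of (D ! i) = NegX \<longrightarrow> d i = \<phi> X Y \<and> Z = neg_under H \<mu> \<phi> X Y))}"

text \<open>The monoidal category of a crossed module: \<open>(U, e, U\<^sub>1)\<close> is the morphism
  from \<open>U\<close> to \<open>U\<^sub>1\<close> given by \<open>e\<close>, where \<open>\<mu> e \<otimes> U = U\<^sub>1\<close>. Composition is in diagrammatic
  order.\<close>

type_synonym ('h, 'p) mor = "'h \<times> 'p \<times> 'h"

definition mor_id :: "('p, 'm) monoid_scheme \<Rightarrow> 'h \<Rightarrow> ('h, 'p) mor" where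
  "mor_id P U = (U, \<one>\<^bsub>P\<^esub>, U)"

fun mor_comp :: "('p, 'm) monoid_scheme \<Rightarrow> ('h, 'p) mor \<Rightarrow> ('h, 'p) mor \<Rightarrow> ('h, 'p) mor" where
  "mor_comp P (U, e, U1) (U1', f, U2) = (U, f \<otimes>\<^bsub>P\<^esub> e, U2)"

fun mor_tensor ::
  "('p, 'm) monoid_scheme \<Rightarrow> ('h, 'n) monoid_scheme \<Rightarrow> ('h \<Rightarrow> 'p \<Rightarrow> 'p) \<Rightarrow>
   ('h, 'p) mor \<Rightarrow> ('h, 'p) mor \<Rightarrow> ('h, 'p) mor" where
  "mor_tensor P H act (U, e, U1) (U', e', U1') =
     (U \<otimes>\<^bsub>H\<^esub> U', act U1 e' \<otimes>\<^bsub>P\<^esub> e, U1 \<otimes>\<^bsub>H\<^esub> U1')"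

fun strand_obj :: "('h, 'n) monoid_scheme \<Rightarrow> dir \<Rightarrow> 'h \<Rightarrow> 'h" where
  "strand_obj H Down X = X"
| "strand_obj H Up X = inv\<^bsub>H\<^esub> X"

definition piece_mor ::
  "('p, 'm) monoid_scheme \<Rightarrow> ('h, 'n) monoid_scheme \<Rightarrow> slice list \<Rightarrow>
   ((nat \<times> nat) set \<Rightarrow> 'h) \<times> (nat \<Rightarrow> 'p) \<Rightarrow> nat \<Rightarrow> ('h, 'p) mor" where
  "piece_mor P H D F i =
     (let c = fst F; d = snd F; m = length (lefts (D ! i));
          X = c (over_arc D i); Y = c (lower_under_arc D i); Z = c (upper_under_arc D i)
      in case piece_of (D ! i) of
           Blank \<Rightarrow> mor_id P \<one>\<^bsub>H\<^esub>
         | PosX \<Rightarrow> (Z \<otimes>\<^bsub>H\<^esub> X, d i, X \<otimes>\<^bsub>H\<^esub> Y)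
         | NegX \<Rightarrow> (X \<otimes>\<^bsub>H\<^esub> Z, d i, Y \<otimes>\<^bsub>H\<^esub> X)
         | Cap a \<Rightarrow> (\<one>\<^bsub>H\<^esub>, \<one>\<^bsub>P\<^esub>, strand_obj H a (c (arc_of D (Suc i, m))) \<otimes>\<^bsub>H\<^esub>
                                   strand_obj H (flip a) (c (arc_of D (Suc i, Suc m))))
         | Cup a \<Rightarrow> (strand_obj H a (c (arc_of D (i, m))) \<otimes>\<^bsub>H\<^esub>
                     strand_obj H (flip a) (c (arc_of D (i, Suc m))), \<one>\<^bsub>P\<^esub>, \<one>\<^bsub>H\<^esub>))"

definition slice_mor ::
  "('p, 'm) monoid_scheme \<Rightarrow> ('h, 'n) monoid_scheme \<Rightarrow> ('h \<Rightarrow> 'p \<Rightarrow> 'p) \<Rightarrow> slice list \<Rightarrow>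
   ((nat \<times> nat) set \<Rightarrow> 'h) \<times> (nat \<Rightarrow> 'p) \<Rightarrow> nat \<Rightarrow> ('h, 'p) mor" where
  "slice_mor P H act D F i =
     (let s = D ! i; c = fst F; m = length (lefts s); k = length (piece_top (piece_of s));
          ls = map (\<lambda>j. mor_id P (strand_obj H (lefts s ! j) (c (arc_of D (i, j)))))
                 [0..<m];
          rs = map (\<lambda>j. mor_id P (strand_obj H (rights s ! j) (c (arc_of D (i, m + k + j)))))
                 [0..<length (rights s)]
      in foldr (mor_tensor P H act) (ls @ [piece_mor P H D F i] @ rs) (mor_id P \<one>\<^bsub>H\<^esub>))"

definition evaluation ::
  "('p, 'm) monoid_scheme \<Rightarrow> ('h, 'n) monoid_scheme \<Rightarrow> ('h \<Rightarrow> 'p \<Rightarrow> 'p) \<Rightarrow> slice list \<Rightarrow>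
   ((nat \<times> nat) set \<Rightarrow> 'h) \<times> (nat \<Rightarrow> 'p) \<Rightarrow> 'p" where
  "evaluation P H act D F =
     fst (snd (foldl (mor_comp P) (mor_id P \<one>\<^bsub>H\<^esub>)
                 (map (slice_mor P H act D F) [0..<length D])))"

text \<open>Elements of \<open>\<int>[A]\<close> are elements of the free abelian group on \<open>A\<close>; \<open>frag_of a\<close> is the
  basis element \<open>a\<close>.\<close>

definition reidemeister_invariant ::
  "('p, 'm) monoid_scheme \<Rightarrow> ('h, 'n) monoid_scheme \<Rightarrow> ('p \<Rightarrow> 'h) \<Rightarrow> ('h \<Rightarrow> 'p \<Rightarrow> 'p) \<Rightarrow>
   ('h \<Rightarrow> 'h \<Rightarrow> 'p) \<Rightarrow> ('h \<Rightarrow> 'h \<Rightarrow> 'p) \<Rightarrow> slice list \<Rightarrow> 'p \<Rightarrow>\<^sub>0 int" where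
  "reidemeister_invariant P H \<mu> act \<psi> \<phi> D =
     (\<Sum>F\<in>reidemeister_colourings P H \<mu> \<psi> \<phi> D. frag_of (evaluation P H act D F))"


section \<open>The rack and quandle cocycle invariant\<close>

definition rack_colourings ::
  "'a set \<Rightarrow> ('a \<Rightarrow> 'a \<Rightarrow> 'a) \<Rightarrow> ('a \<Rightarrow> 'a \<Rightarrow> 'a) \<Rightarrow> slice list \<Rightarrow>
   ((nat \<times> nat) set \<Rightarrow> 'a) set" where
  "rack_colourings R rtri ltri D =
     {c. c \<in> arcs D \<rightarrow>\<^sub>E R \<and>
        (\<forall>i\<in>crossings D.
           let y = c (over_arc D i); x = c (lower_under_arc D i); z = c (upper_under_arc D i)
           in (piece_of (D ! i) = PosX \<longrightarrow> z = rtri y x) \<and>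
              (piece_of (D ! i) = NegX \<longrightarrow> z = ltri x y))}"

definition crossing_weight ::
  "('a \<Rightarrow> 'a \<Rightarrow> 'a) \<Rightarrow> ('a \<Rightarrow> 'a \<Rightarrow> 'v) \<Rightarrow> slice list \<Rightarrow> ((nat \<times> nat) set \<Rightarrow> 'a) \<Rightarrow> nat \<Rightarrow> 'v" where
  "crossing_weight rtri w D c i =
     (let y = c (over_arc D i); x = c (lower_under_arc D i)
      in if piece_of (D ! i) = PosX then w (rtri y x) y else w x y)"

definition cocycle_invariant ::
  "'a set \<Rightarrow> ('a \<Rightarrow> 'a \<Rightarrow> 'a) \<Rightarrow> ('a \<Rightarrow> 'a \<Rightarrow> 'a) \<Rightarrow> ('v, 'n) monoid_scheme \<Rightarrow>
   ('a \<Rightarrow> 'a \<Rightarrow> 'v) \<Rightarrow> slice list \<Rightarrow> 'v \<Rightarrow>\<^sub>0 int" where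
  "cocycle_invariant R rtri ltri V w D =
     (\<Sum>c\<in>rack_colourings R rtri ltri D.
        frag_of (\<Otimes>\<^bsub>V\<^esub>i\<in>crossings D. crossing_weight rtri w D c i [^]\<^bsub>V\<^esub> crossing_sign D i))"


section \<open>The crossed module and the Reidemeister pair of a rack cocycle\<close>

definition conj_act :: "('a, 'm) monoid_scheme \<Rightarrow> 'a \<Rightarrow> 'a \<times> 'v \<Rightarrow> 'a \<times> 'v" where
  "conj_act G g hv = (g \<otimes>\<^bsub>G\<^esub> fst hv \<otimes>\<^bsub>G\<^esub> inv\<^bsub>G\<^esub> g, snd hv)"

definition rack_psi ::
  "('a, 'm) monoid_scheme \<Rightarrow> ('a \<Rightarrow> 'a \<Rightarrow> 'a) \<Rightarrow> ('a \<Rightarrow> 'a \<Rightarrow> 'v) \<Rightarrow> 'a \<Rightarrow> 'a \<Rightarrow> 'a \<times> 'v" where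
  "rack_psi G rtri w B A =
     (B \<otimes>\<^bsub>G\<^esub> A \<otimes>\<^bsub>G\<^esub> inv\<^bsub>G\<^esub> B \<otimes>\<^bsub>G\<^esub> inv\<^bsub>G\<^esub> (rtri B A), w (rtri B A) B)"

definition rack_phi ::
  "('a, 'm) monoid_scheme \<Rightarrow> ('v, 'n) monoid_scheme \<Rightarrow> ('a \<Rightarrow> 'a \<Rightarrow> 'a) \<Rightarrow> ('a \<Rightarrow> 'a \<Rightarrow> 'v) \<Rightarrow>
   'a \<Rightarrow> 'a \<Rightarrow> 'a \<times> 'v" where
  "rack_phi G V ltri w B A =
     (A \<otimes>\<^bsub>G\<^esub> B \<otimes>\<^bsub>G\<^esub> inv\<^bsub>G\<^esub> (ltri A B) \<otimes>\<^bsub>G\<^esub> inv\<^bsub>G\<^esub> B, inv\<^bsub>V\<^esub> (w A B))"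

end

theory Submission
  imports Defs
begin

text \<open>With these \<open>\<psi>\<close> and \<open>\<phi>\<close> the group factors cancel, so that the upper under arc at a crossing is
  \<open>X \<triangleright> Y\<close>, respectively \<open>Y \<triangleleft> X\<close>: Reidemeister colourings are rack colourings, R2 and R3 reduce to
  the rack axioms and the cocycle identity, and the framing maps are \<open>x \<mapsto> x \<triangleright> x\<close> and its inverse
  \<open>x \<mapsto> x \<triangleleft> x\<close>. The projection \<open>G \<times> V \<rightarrow> V\<close> is a homomorphism invariant under the action, hence it
  maps the evaluation of a colouring to the product over all crossings, in any order, of the
  \<open>V\<close>-components. The \<open>G\<close>-component is the unit, because each strip contributes a
  morphism between the objects of its two boundary lines and the first and last line are empty.\<close>

section \<open>Racks\<close>

context rack
begin

text \<open>Self-distributivity at \<open>x\<close>, \<open>x\<close>,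
  \<open>y \<triangleleft> x\<close>, where \<open>x \<triangleright> (y \<triangleleft> x)\<close>
  collapses to \<open>y\<close>. In a general rack this does the work of idempotency.\<close>

lemma rtri_square: "x \<in> R \<Longrightarrow> y \<in> R \<Longrightarrow> (x \<triangleright> x) \<triangleright> y = x \<triangleright> y"
  using rtri_distrib[of x x "y \<triangleleft> x"] by (simp add: rtri_ltri ltri_closed)

lemma ltri_square: "x \<in> R \<Longrightarrow> y \<in> R \<Longrightarrow> y \<triangleleft> (x \<triangleleft> x) = y \<triangleleft> x"
  using ltri_distrib[of "x \<triangleright> y" x x] by (simp add: ltri_rtri rtri_closed)

text \<open>By \<open>rtri_square\<close>, \<open>x \<triangleright> x\<close> equals
  \<open>(x \<triangleright> x) \<triangleright> x\<close>, which \<open>ltri_rtri\<close> undoes.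
  Together with the next lemma this makes the two squaring maps mutually inverse.\<close>

lemma ltri_self_rtri_self: "x \<in> R \<Longrightarrow> (x \<triangleright> x) \<triangleleft> (x \<triangleright> x) = x"
  using ltri_rtri[of "x \<triangleright> x" x] by (simp add: rtri_square rtri_closed)

lemma rtri_self_ltri_self: "x \<in> R \<Longrightarrow> (x \<triangleleft> x) \<triangleright> (x \<triangleleft> x) = x"
  using rtri_ltri[of "x \<triangleleft> x" x] by (simp add: ltri_square ltri_closed)

text \<open>Solves the framing equation once its group factors are gone: applying
  \<open>a \<triangleright>\<close> to it gives \<open>a \<triangleright> a = z\<close>, and
  squaring is invertible.\<close>

lemma ltri_eq_self_iff:
  assumes "a \<in> R" "z \<in> R"
  shows "z \<triangleleft> a = a \<longleftrightarrow> a = z \<triangleleft> z"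
proof
  assume "z \<triangleleft> a = a"
  then have "a \<triangleright> a = z" using rtri_ltri[OF assms] by simp
  then show "a = z \<triangleleft> z" using ltri_self_rtri_self[OF assms(1)] by simp
next
  assume "a = z \<triangleleft> z"
  then show "z \<triangleleft> a = a" using ltri_square[OF assms(2,2)] by simp
qed

end

section \<open>Horizontal lines and arcs of a link diagram\<close>

text \<open>The empty default also serves the bottom line, number \<open>length D\<close>, so that
  all lines of a link diagram are treated uniformly.\<close>

definition line_dirs :: "slice list \<Rightarrow> nat \<Rightarrow> dir list" where
  "line_dirs D i = (if i < length D then slice_top (D ! i) else [])"

lemma tangle_diagram_slices:
  assumes "tangle_diagram u D v" "i < length D"
  shows "slice_bot (D ! i) = (if Suc i < length D then slice_top (D ! Suc i) else v)"
  using assms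
proof (induction D arbitrary: u i)
  case (Cons s D)
  show ?case
  proof (cases i)
    case 0
    with Cons.prems show ?thesis by (cases D) auto
  next
    case (Suc k)
    with Cons.prems Cons.IH[of "slice_bot s" k] show ?thesis by auto
  qed
qed simp

lemma line_dirs_Suc:
  assumes "link_diagram D" "i < length D"
  shows "line_dirs D (Suc i) = slice_bot (D ! i)"
  using tangle_diagram_slices[of "[]" D "[]" i] assms
  by (auto simp: link_diagram_def line_dirs_def)

lemma line_dirs_0: "link_diagram D \<Longrightarrow> line_dirs D 0 = []"
  by (cases D) (auto simp: link_diagram_def line_dirs_def)

lemma points_iff: "(i, j) \<in> points D \<longleftrightarrow> j < length (line_dirs D i)"
  by (auto simp: points_def line_dirs_def)

lemma finite_arcs: "finite (arcs D)"
proof -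
  have "points D = (SIGMA i:{..<length D}. {..<length (slice_top (D ! i))})"
    by (auto simp: points_def)
  then show ?thesis by (simp add: arcs_def)
qed

lemma finite_crossings: "finite (crossings D)"
  by (simp add: crossings_def)

lemma arc_of_joined:
  assumes "joined D p q"
  shows "arc_of D p = arc_of D q"
proof -
  have "equivclp (joined D) p q" using assms by (rule r_into_equivclp)
  then show ?thesis
    unfolding arc_of_def by (blast intro: equivclp_trans equivclp_sym)
qed

lemma arc_of_in_arcs: "j < length (line_dirs D i) \<Longrightarrow> arc_of D (i, j) \<in> arcs D"
  by (simp add: arcs_def points_iff)

text \<open>The lower under arc is read off on line \<open>Suc i\<close>. In a link diagram this
  line is the bottom of strip \<open>i\<close>, so it contains the two lower ends of the
  crossing.\<close>

lemma crossing_arcs_in_arcs: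
  assumes "link_diagram D" "i \<in> crossings D"
  shows "over_arc D i \<in> arcs D" "upper_under_arc D i \<in> arcs D" "lower_under_arc D i \<in> arcs D"
  using assms line_dirs_Suc[of D i]
  by (auto simp: crossings_def over_arc_def upper_under_arc_def lower_under_arc_def Let_def
      line_dirs_def slice_top_def slice_bot_def intro!: arc_of_in_arcs)

lemma finite_rack_colourings: "finite R \<Longrightarrow> finite (rack_colourings R rtri ltri D)"
  by (rule finite_subset[OF _ finite_PiE[OF finite_arcs, of D "\<lambda>_. R"]])
     (auto simp: rack_colourings_def)

section \<open>Evaluating a coloured link\<close>

text \<open>The tensor product of the strands met by a line, where \<open>f j\<close> colours the
  \<open>j\<close>-th point from the left. Shifting \<open>f\<close> numbers the remaining points
  from 0 again.\<close>

fun word_obj :: "('h, 'n) monoid_scheme \<Rightarrow> dir list \<Rightarrow> (nat \<Rightarrow> 'h) \<Rightarrow> 'h" where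
  "word_obj H [] f = \<one>\<^bsub>H\<^esub>"
| "word_obj H (d # ds) f = strand_obj H d (f 0) \<otimes>\<^bsub>H\<^esub> word_obj H ds (\<lambda>j. f (Suc j))"

lemma word_obj_cong:
  "(\<And>j. j < length ds \<Longrightarrow> f j = g j) \<Longrightarrow> word_obj H ds f = word_obj H ds g"
proof (induction ds arbitrary: f g)
  case (Cons d ds)
  have "word_obj H ds (\<lambda>j. f (Suc j)) = word_obj H ds (\<lambda>j. g (Suc j))"
    by (rule Cons.IH) (simp add: Cons.prems)
  with Cons.prems[of 0] show ?case by simp
qed simp

context group
begin

lemma mult_inv_cancel:
  assumes "a \<in> carrier G" "b \<in> carrier G"
  shows "a \<otimes> (inv a \<otimes> b) = b" "inv a \<otimes> (a \<otimes> b) = b"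
  using assms by (simp_all flip: m_assoc)

lemma strand_obj_closed: "x \<in> carrier G \<Longrightarrow> strand_obj G d x \<in> carrier G"
  by (cases d) auto

text \<open>The reason why cups and caps are morphisms with unit element: their two ends lie on one
  arc and have opposite directions.\<close>

lemma strand_obj_flip: "x \<in> carrier G \<Longrightarrow> strand_obj G d x \<otimes> strand_obj G (flip d) x = \<one>"
  by (cases d) auto

lemma word_obj_closed:
  "(\<And>j. j < length ds \<Longrightarrow> f j \<in> carrier G) \<Longrightarrow> word_obj G ds f \<in> carrier G"
  by (induction ds arbitrary: f) (auto intro!: m_closed strand_obj_closed)

lemma word_obj_append:
  assumes "\<And>j. j < length xs + length ys \<Longrightarrow> f j \<in> carrier G"
  shows "word_obj G (xs @ ys) f = word_obj G xs f \<otimes> word_obj G ys (\<lambda>j. f (length xs + j))"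
  using assms
proof (induction xs arbitrary: f)
  case Nil
  then show ?case by (simp add: word_obj_closed)
next
  case (Cons x xs)
  have IH: "word_obj G (xs @ ys) (\<lambda>j. f (Suc j)) =
      word_obj G xs (\<lambda>j. f (Suc j)) \<otimes> word_obj G ys (\<lambda>j. f (Suc (length xs + j)))"
    by (rule Cons.IH) (simp add: Cons.prems)
  have "strand_obj G x (f 0) \<in> carrier G" "word_obj G xs (\<lambda>j. f (Suc j)) \<in> carrier G"
    "word_obj G ys (\<lambda>j. f (Suc (length xs + j))) \<in> carrier G"
    by (auto intro!: strand_obj_closed word_obj_closed Cons.prems)
  with IH show ?case by (simp add: m_assoc)
qed

end

section \<open>Strips in the monoidal category of a crossed module\<close>

context crossed_module
begin

lemma mu_closed: "e \<in> carrier P \<Longrightarrow> \<mu> e \<in> carrier H"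
  using mu_hom by (rule hom_in_carrier)

lemma act_closed: "g \<in> carrier H \<Longrightarrow> e \<in> carrier P \<Longrightarrow> act g e \<in> carrier P"
  by (rule hom_in_carrier[OF act_hom])

lemma act_unit: "g \<in> carrier H \<Longrightarrow> act g \<one>\<^bsub>P\<^esub> = \<one>\<^bsub>P\<^esub>"
  by (rule hom_one[OF act_hom P.group_axioms P.group_axioms])

text \<open>Tensoring with the identity of \<open>A\<close> on the left turns \<open>e\<close> into
  \<open>act A e\<close>; over several strands the actions compose by
  \<open>act_mult\<close>.\<close>

lemma tensor_identities:
  assumes "\<And>j. j < length ds \<Longrightarrow> f j \<in> carrier H"
    and "U \<in> carrier H" "e \<in> carrier P" "U1 \<in> carrier H"
  shows "foldr (mor_tensor P H act)
           (map (\<lambda>j. mor_id P (strand_obj H (ds ! j) (f j))) [0..<length ds]) (U, e, U1) =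
         (word_obj H ds f \<otimes>\<^bsub>H\<^esub> U, act (word_obj H ds f) e, word_obj H ds f \<otimes>\<^bsub>H\<^esub> U1)"
  using assms(1)
proof (induction ds arbitrary: f)
  case Nil
  then show ?case using assms by (simp add: act_one)
next
  case (Cons d ds)
  have IH: "foldr (mor_tensor P H act)
           (map (\<lambda>j. mor_id P (strand_obj H (ds ! j) (f (Suc j)))) [0..<length ds]) (U, e, U1) =
         (word_obj H ds (\<lambda>j. f (Suc j)) \<otimes>\<^bsub>H\<^esub> U, act (word_obj H ds (\<lambda>j. f (Suc j))) e,
          word_obj H ds (\<lambda>j. f (Suc j)) \<otimes>\<^bsub>H\<^esub> U1)"
    by (rule Cons.IH) (simp add: Cons.prems)
  \<comment> \<open>Splits off position 0, so that the induction hypothesis applies to the colouring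
    shifted by one.\<close>
  have split: "[0..<length (d # ds)] = 0 # map Suc [0..<length ds]"
    by (simp add: map_Suc_upt upt_conv_Cons del: upt_Suc)
  have cl: "strand_obj H d (f 0) \<in> carrier H" "word_obj H ds (\<lambda>j. f (Suc j)) \<in> carrier H"
    by (auto intro!: H.strand_obj_closed H.word_obj_closed Cons.prems)
  show ?case unfolding split using IH cl assms(2-)
    by (simp add: o_def mor_id_def H.m_assoc act_mult act_closed)
qed

text \<open>Strands to the right contribute \<open>act U1 \<one>\<close>, a unit, so only the
  strands to the left alter the element of the piece.\<close>

lemma slice_tensor:
  assumes "\<And>j. j < length ls \<Longrightarrow> f j \<in> carrier H" "\<And>j. j < length rs \<Longrightarrow> g j \<in> carrier H"
    and "U \<in> carrier H" "e \<in> carrier P" "U1 \<in> carrier H"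
  shows "foldr (mor_tensor P H act)
           (map (\<lambda>j. mor_id P (strand_obj H (ls ! j) (f j))) [0..<length ls] @ [(U, e, U1)] @
            map (\<lambda>j. mor_id P (strand_obj H (rs ! j) (g j))) [0..<length rs])
           (mor_id P \<one>\<^bsub>H\<^esub>) =
         (word_obj H ls f \<otimes>\<^bsub>H\<^esub> (U \<otimes>\<^bsub>H\<^esub> word_obj H rs g), act (word_obj H ls f) e,
          word_obj H ls f \<otimes>\<^bsub>H\<^esub> (U1 \<otimes>\<^bsub>H\<^esub> word_obj H rs g))"
proof -
  have cl: "word_obj H ls f \<in> carrier H" "word_obj H rs g \<in> carrier H"
    using assms by (auto intro!: H.word_obj_closed)
  have "foldr (mor_tensor P H act)
            (map (\<lambda>j. mor_id P (strand_obj H (rs ! j) (g j))) [0..<length rs])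
           (mor_id P \<one>\<^bsub>H\<^esub>) = (word_obj H rs g, \<one>\<^bsub>P\<^esub>, word_obj H rs g)"
    using tensor_identities[of rs g "\<one>\<^bsub>H\<^esub>" "\<one>\<^bsub>P\<^esub>" "\<one>\<^bsub>H\<^esub>"] assms cl
    by (simp add: mor_id_def act_unit)
  then show ?thesis
    using tensor_identities[of ls f "U \<otimes>\<^bsub>H\<^esub> word_obj H rs g" e "U1 \<otimes>\<^bsub>H\<^esub> word_obj H rs g"]
      assms cl by (simp add: act_unit)
qed

text \<open>By equivariance \<open>\<mu> (act A e)\<close> is the conjugate of
  \<open>\<mu> e\<close> by \<open>A\<close>, and its last factor cancels against \<open>A\<close>.
  Hence a morphism padded by strands is again a morphism.\<close>

lemma mu_act_morphism:
  assumes "A \<in> carrier H" "B \<in> carrier H" "U \<in> carrier H" "e \<in> carrier P" "\<mu> e \<otimes>\<^bsub>H\<^esub> U = U1"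
  shows "\<mu> (act A e) \<otimes>\<^bsub>H\<^esub> (A \<otimes>\<^bsub>H\<^esub> (U \<otimes>\<^bsub>H\<^esub> B)) = A \<otimes>\<^bsub>H\<^esub> (U1 \<otimes>\<^bsub>H\<^esub> B)"
proof -
  have "\<mu> (act A e) \<otimes>\<^bsub>H\<^esub> (A \<otimes>\<^bsub>H\<^esub> (U \<otimes>\<^bsub>H\<^esub> B)) =
      A \<otimes>\<^bsub>H\<^esub> (\<mu> e \<otimes>\<^bsub>H\<^esub> (inv\<^bsub>H\<^esub> A \<otimes>\<^bsub>H\<^esub> (A \<otimes>\<^bsub>H\<^esub> (U \<otimes>\<^bsub>H\<^esub> B))))"
    using assms by (simp add: equivariance H.m_assoc mu_closed)
  then show ?thesis using assms by (auto simp: H.m_assoc H.mult_inv_cancel mu_closed)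
qed

lemma mu_pos_crossing:
  assumes "X \<in> carrier H" "Y \<in> carrier H" "\<psi> X Y \<in> carrier P"
  shows "\<mu> (\<psi> X Y) \<otimes>\<^bsub>H\<^esub> (pos_under H \<mu> \<psi> X Y \<otimes>\<^bsub>H\<^esub> X) = X \<otimes>\<^bsub>H\<^esub> Y"
  using assms mu_closed[OF assms(3)] by (simp add: pos_under_def H.m_assoc H.mult_inv_cancel)

lemma mu_neg_crossing:
  assumes "X \<in> carrier H" "Y \<in> carrier H" "\<phi> X Y \<in> carrier P"
  shows "\<mu> (\<phi> X Y) \<otimes>\<^bsub>H\<^esub> (X \<otimes>\<^bsub>H\<^esub> neg_under H \<mu> \<phi> X Y) = Y \<otimes>\<^bsub>H\<^esub> X"
  using assms mu_closed[OF assms(3)] by (simp add: neg_under_def H.m_assoc H.mult_inv_cancel)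

end

section \<open>Evaluation of one coloured link diagram\<close>

locale coloured_link = crossed_module P H \<mu> act
  for P :: "('p, 'm) monoid_scheme" and H :: "('h, 'n) monoid_scheme"
    and \<mu> :: "'p \<Rightarrow> 'h" and act :: "'h \<Rightarrow> 'p \<Rightarrow> 'p" +
  fixes \<psi> \<phi> :: "'h \<Rightarrow> 'h \<Rightarrow> 'p" and D :: "slice list"
    and c :: "(nat \<times> nat) set \<Rightarrow> 'h" and d :: "nat \<Rightarrow> 'p"
  assumes link: "link_diagram D"
    and colouring: "(c, d) \<in> reidemeister_colourings P H \<mu> \<psi> \<phi> D"
begin

abbreviation colour :: "nat \<Rightarrow> nat \<Rightarrow> 'h" where
  "colour i j \<equiv> c (arc_of D (i, j))"

abbreviation line_obj :: "nat \<Rightarrow> 'h" where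
  "line_obj i \<equiv> word_obj H (line_dirs D i) (colour i)"

text \<open>\<open>d\<close> is extensional and so carries no information off the crossings; the
  unit is the element of blanks, cups and caps.\<close>

abbreviation crossing_elt :: "nat \<Rightarrow> 'p" where
  "crossing_elt i \<equiv> (if i \<in> crossings D then d i else \<one>\<^bsub>P\<^esub>)"

lemma arc_colour_closed: "a \<in> arcs D \<Longrightarrow> c a \<in> carrier H"
  using colouring by (auto simp: reidemeister_colourings_def)

lemma colour_closed: "j < length (line_dirs D i) \<Longrightarrow> colour i j \<in> carrier H"
  by (simp add: arc_colour_closed arc_of_in_arcs)

lemma crossing_closed: "i \<in> crossings D \<Longrightarrow> d i \<in> carrier P"
  using colouring by (auto simp: reidemeister_colourings_def)

text \<open>\<open>piece_mor\<close> is given by arcs, composition needs the words on the two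
  boundary lines. They agree because the over strand and the two ends of a cap or cup each have a
  single colour.\<close>

lemma piece_mor_eq:
  assumes "i < length D" "D ! i = Slice l p r"
  defines "U \<equiv> word_obj H (piece_top p) (\<lambda>j. colour i (length l + j))"
    and "U1 \<equiv> word_obj H (piece_bot p) (\<lambda>j. colour (Suc i) (length l + j))"
  shows "piece_mor P H D (c, d) i = (U, crossing_elt i, U1)"
    and "\<mu> (crossing_elt i) \<otimes>\<^bsub>H\<^esub> U = U1"
proof -
  let ?X = "c (over_arc D i)" and ?Y = "c (lower_under_arc D i)" and ?Z = "c (upper_under_arc D i)"
  have mu1: "\<mu> \<one>\<^bsub>P\<^esub> = \<one>\<^bsub>H\<^esub>"
    using hom_one[OF mu_hom P.group_axioms H.group_axioms] .
  have top: "colour i (length l + j) \<in> carrier H" if "j < length (piece_top p)" for j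
    using that assms(1,2) by (intro colour_closed) (simp add: line_dirs_def slice_top_def)
  have bot: "colour (Suc i) (length l + j) \<in> carrier H" if "j < length (piece_bot p)" for j
    using that assms(1,2) by (intro colour_closed) (simp add: line_dirs_Suc[OF link] slice_bot_def)
  have cr: "i \<in> crossings D \<longleftrightarrow> p = PosX \<or> p = NegX"
    using assms(1,2) by (simp add: crossings_def)
  have XYZ: "?X \<in> carrier H" "?Y \<in> carrier H" "?Z \<in> carrier H" if "i \<in> crossings D"
    using crossing_arcs_in_arcs[OF link that] by (simp_all add: arc_colour_closed)
  have rule: "(p = PosX \<longrightarrow> d i = \<psi> ?X ?Y \<and> ?Z = pos_under H \<mu> \<psi> ?X ?Y) \<and>
              (p = NegX \<longrightarrow> d i = \<phi> ?X ?Y \<and> ?Z = neg_under H \<mu> \<phi> ?X ?Y)"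
    if "i \<in> crossings D"
    using colouring that assms(2) by (auto simp: reidemeister_colourings_def Let_def)
  have "piece_mor P H D (c, d) i = (U, crossing_elt i, U1) \<and>
        \<mu> (crossing_elt i) \<otimes>\<^bsub>H\<^esub> U = U1"
  proof (cases p)
    case Blank
    then show ?thesis using assms(1,2) cr mu1
      by (simp add: U_def U1_def piece_mor_def mor_id_def)
  next
    case PosX
    \<comment> \<open>The over strand is not cut, so its top right and bottom left ends share the
      colour \<open>?X\<close>.\<close>
    have "joined D (i, Suc (length l)) (Suc i, length l)"
      using assms(1,2) PosX by (auto intro: joined.over_pos)
    then have eq: "colour (Suc i) (length l) = colour i (Suc (length l))"
      by (rule arg_cong[where f = c, OF arc_of_joined, symmetric])
    have ic: "i \<in> crossings D" using PosX cr by simp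
    have arcs: "?X = colour i (Suc (length l))" "?Z = colour i (length l)"
      "?Y = colour (Suc i) (Suc (length l))"
      using assms(2) PosX by (simp_all add: over_arc_def upper_under_arc_def lower_under_arc_def)
    have "U = ?Z \<otimes>\<^bsub>H\<^esub> ?X" "U1 = ?X \<otimes>\<^bsub>H\<^esub> ?Y"
      using PosX XYZ[OF ic] eq arcs by (simp_all add: U_def U1_def)
    moreover have "\<mu> (d i) \<otimes>\<^bsub>H\<^esub> (?Z \<otimes>\<^bsub>H\<^esub> ?X) = ?X \<otimes>\<^bsub>H\<^esub> ?Y"
      using rule[OF ic] PosX mu_pos_crossing[of ?X ?Y \<psi>] XYZ[OF ic] crossing_closed[OF ic]
      by simp
    ultimately show ?thesis using PosX assms(2) ic by (simp add: piece_mor_def Let_def)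
  next
    case NegX
    have "joined D (i, length l) (Suc i, Suc (length l))"
      using assms(1,2) NegX by (auto intro: joined.over_neg)
    then have eq: "colour (Suc i) (Suc (length l)) = colour i (length l)"
      by (rule arg_cong[where f = c, OF arc_of_joined, symmetric])
    have ic: "i \<in> crossings D" using NegX cr by simp
    have arcs: "?X = colour i (length l)" "?Z = colour i (Suc (length l))"
      "?Y = colour (Suc i) (length l)"
      using assms(2) NegX by (simp_all add: over_arc_def upper_under_arc_def lower_under_arc_def)
    have "U = ?X \<otimes>\<^bsub>H\<^esub> ?Z" "U1 = ?Y \<otimes>\<^bsub>H\<^esub> ?X"
      using NegX XYZ[OF ic] eq arcs by (simp_all add: U_def U1_def)
    moreover have "\<mu> (d i) \<otimes>\<^bsub>H\<^esub> (?X \<otimes>\<^bsub>H\<^esub> ?Z) = ?Y \<otimes>\<^bsub>H\<^esub> ?X"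
      using rule[OF ic] NegX mu_neg_crossing[of ?X ?Y \<phi>] XYZ[OF ic] crossing_closed[OF ic]
      by simp
    ultimately show ?thesis using NegX assms(2) ic by (simp add: piece_mor_def Let_def)
  next
    case (Cap a)
    have "joined D (Suc i, length l) (Suc i, Suc (length l))"
      using assms(1,2) Cap by (auto intro: joined.cap)
    then have eq: "colour (Suc i) (Suc (length l)) = colour (Suc i) (length l)"
      by (rule arg_cong[where f = c, OF arc_of_joined, symmetric])
    have x: "colour (Suc i) (length l) \<in> carrier H" using bot[of 0] Cap by simp
    then show ?thesis using Cap eq cr assms(2) mu1 H.strand_obj_closed[OF x]
      by (simp add: U_def U1_def piece_mor_def Let_def H.strand_obj_flip)
  next
    case (Cup a)
    have "joined D (i, length l) (i, Suc (length l))"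
      using assms(1,2) Cup by (auto intro: joined.cup)
    then have eq: "colour i (Suc (length l)) = colour i (length l)"
      by (rule arg_cong[where f = c, OF arc_of_joined, symmetric])
    have x: "colour i (length l) \<in> carrier H" using top[of 0] Cup by simp
    then show ?thesis using Cup eq cr assms(2) mu1 H.strand_obj_closed[OF x]
      by (simp add: U_def U1_def piece_mor_def Let_def H.strand_obj_flip)
  qed
  then show "piece_mor P H D (c, d) i = (U, crossing_elt i, U1)"
    and "\<mu> (crossing_elt i) \<otimes>\<^bsub>H\<^esub> U = U1" by auto
qed

text \<open>\<open>A\<close> is the object of the strands left of the piece. Its value may stay
  hidden, since \<open>\<pi>\<close> below is invariant under the action.\<close>

lemma slice_mor_eq:
  assumes "i < length D"
  obtains A where "A \<in> carrier H"
    and "slice_mor P H act D (c, d) i = (line_obj i, act A (crossing_elt i), line_obj (Suc i))"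
    and "\<mu> (act A (crossing_elt i)) \<otimes>\<^bsub>H\<^esub> line_obj i = line_obj (Suc i)"
proof -
  obtain l p r where s: "D ! i = Slice l p r" by (cases "D ! i") auto
  let ?t = "length l + length (piece_top p)" and ?b = "length l + length (piece_bot p)"
  define A where "A = word_obj H l (colour i)"
  define B where "B = word_obj H r (\<lambda>j. colour i (?t + j))"
  define U where "U = word_obj H (piece_top p) (\<lambda>j. colour i (length l + j))"
  define U1 where "U1 = word_obj H (piece_bot p) (\<lambda>j. colour (Suc i) (length l + j))"
  have dirs: "line_dirs D i = l @ piece_top p @ r" "line_dirs D (Suc i) = l @ piece_bot p @ r"
    using assms s by (simp_all add: line_dirs_def[of D i] line_dirs_Suc[OF link] slice_top_def
        slice_bot_def)
  have cl: "colour i j \<in> carrier H" if "j < ?t + length r" for j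
    using that dirs by (intro colour_closed) simp
  have cl': "colour (Suc i) j \<in> carrier H" if "j < ?b + length r" for j
    using that dirs by (intro colour_closed) simp
  have carr: "A \<in> carrier H" "B \<in> carrier H" "U \<in> carrier H" "U1 \<in> carrier H"
    unfolding A_def B_def U_def U1_def by (auto intro!: H.word_obj_closed cl cl')
  have top: "line_obj i = A \<otimes>\<^bsub>H\<^esub> (U \<otimes>\<^bsub>H\<^esub> B)"
    unfolding dirs A_def B_def U_def
    by (subst H.word_obj_append, simp add: cl, subst H.word_obj_append)
       (auto simp: cl add.assoc)
  \<comment> \<open>Vertical lines stay on their arcs, so the outer words agree on both lines; right
    of the piece the offset changes from \<open>?t\<close> to \<open>?b\<close>.\<close>
  have "word_obj H l (colour (Suc i)) = A"
    unfolding A_def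
    by (rule word_obj_cong) (metis arc_of_joined joined.left assms s)
  moreover have "word_obj H r (\<lambda>j. colour (Suc i) (?b + j)) = B"
    unfolding B_def
    by (rule word_obj_cong) (metis arc_of_joined joined.right assms s)
  ultimately have bot: "line_obj (Suc i) = A \<otimes>\<^bsub>H\<^esub> (U1 \<otimes>\<^bsub>H\<^esub> B)"
    unfolding dirs U1_def
    by (subst H.word_obj_append, simp add: cl', subst H.word_obj_append)
       (auto simp: cl' add.assoc)
  note piece = piece_mor_eq[OF assms s, folded U_def U1_def]
  have e: "crossing_elt i \<in> carrier P" using crossing_closed by auto
  have "slice_mor P H act D (c, d) i =
      (A \<otimes>\<^bsub>H\<^esub> (U \<otimes>\<^bsub>H\<^esub> B), act A (crossing_elt i), A \<otimes>\<^bsub>H\<^esub> (U1 \<otimes>\<^bsub>H\<^esub> B))"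
    using slice_tensor[of l "colour i" r "\<lambda>j. colour i (?t + j)" U "crossing_elt i" U1]
      cl carr e piece(1)
    by (simp add: slice_mor_def Let_def s A_def B_def)
  then show thesis
    using that[of A] carr mu_act_morphism[OF carr(1,2,3) e piece(2)] top bot by simp
qed

text \<open>The first morphism starts at the unit object, so \<open>\<mu>\<close> of the element accumulated down to line
  \<open>n\<close> is the object of that line itself.\<close>

lemma evaluation_prefix:
  assumes "comm_group V" "\<pi> \<in> hom P V"
    and inv: "\<And>g e. g \<in> carrier H \<Longrightarrow> e \<in> carrier P \<Longrightarrow> \<pi> (act g e) = \<pi> e"
    and "n \<le> length D"
  obtains e where "e \<in> carrier P" "\<mu> e = line_obj n"
    and "foldl (mor_comp P) (mor_id P \<one>\<^bsub>H\<^esub>) (map (slice_mor P H act D (c, d)) [0..<n]) =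
         (\<one>\<^bsub>H\<^esub>, e, line_obj n)"
    and "\<pi> e = (\<Otimes>\<^bsub>V\<^esub>i\<in>crossings D \<inter> {..<n}. \<pi> (d i))"
  using \<open>n \<le> length D\<close>
proof (induction n arbitrary: thesis)
  case 0
  interpret V: comm_group V by fact
  show ?case
    by (rule "0.prems"(1)[of "\<one>\<^bsub>P\<^esub>"])
       (use hom_one[OF mu_hom P.group_axioms H.group_axioms]
          hom_one[OF \<open>\<pi> \<in> hom P V\<close> P.group_axioms V.group_axioms]
        in \<open>simp_all add: line_dirs_0[OF link] mor_id_def\<close>)
next
  case (Suc n)
  interpret V: comm_group V by fact
  obtain e where e: "e \<in> carrier P" "\<mu> e = line_obj n"
    "foldl (mor_comp P) (mor_id P \<one>\<^bsub>H\<^esub>) (map (slice_mor P H act D (c, d)) [0..<n]) =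
       (\<one>\<^bsub>H\<^esub>, e, line_obj n)"
    "\<pi> e = (\<Otimes>\<^bsub>V\<^esub>i\<in>crossings D \<inter> {..<n}. \<pi> (d i))"
    using Suc.IH Suc.prems(2) by auto
  obtain A where A: "A \<in> carrier H"
    "slice_mor P H act D (c, d) n = (line_obj n, act A (crossing_elt n), line_obj (Suc n))"
    "\<mu> (act A (crossing_elt n)) \<otimes>\<^bsub>H\<^esub> line_obj n = line_obj (Suc n)"
    using slice_mor_eq[of n] Suc.prems(2) by auto
  let ?a = "act A (crossing_elt n)"
  have x: "crossing_elt n \<in> carrier P" using crossing_closed by auto
  then have a: "?a \<in> carrier P" by (rule act_closed[OF A(1)])
  have pi: "\<pi> (d i) \<in> carrier V" if "i \<in> crossings D" for i
    using that crossing_closed assms(2) by (auto intro: hom_in_carrier)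
  show ?case
  proof (rule Suc.prems(1)[of "?a \<otimes>\<^bsub>P\<^esub> e"])
    show "?a \<otimes>\<^bsub>P\<^esub> e \<in> carrier P" using a e(1) by simp
    show "\<mu> (?a \<otimes>\<^bsub>P\<^esub> e) = line_obj (Suc n)"
      using hom_mult[OF mu_hom a e(1)] e(2) A(3) by simp
    show "foldl (mor_comp P) (mor_id P \<one>\<^bsub>H\<^esub>) (map (slice_mor P H act D (c, d)) [0..<Suc n]) =
       (\<one>\<^bsub>H\<^esub>, ?a \<otimes>\<^bsub>P\<^esub> e, line_obj (Suc n))"
      using e(3) A(2) by simp
    \<comment> \<open>Invariance of \<open>\<pi>\<close> removes \<open>A\<close>. The factor left
      for strip \<open>n\<close> is either a new factor of the product or the unit.\<close>
    have "\<pi> (?a \<otimes>\<^bsub>P\<^esub> e) = \<pi> (crossing_elt n) \<otimes>\<^bsub>V\<^esub> \<pi> e"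
      using hom_mult[OF assms(2) a e(1)] inv[OF A(1) x] by simp
    also have "\<dots> = (\<Otimes>\<^bsub>V\<^esub>i\<in>crossings D \<inter> {..<Suc n}. \<pi> (d i))"
    proof (cases "n \<in> crossings D")
      case True
      then have "crossings D \<inter> {..<Suc n} = insert n (crossings D \<inter> {..<n})" by auto
      with True show ?thesis
        using e(4) pi by (simp add: finite_crossings Pi_def)
    next
      case False
      then have "crossings D \<inter> {..<Suc n} = crossings D \<inter> {..<n}"
        by (auto simp: less_Suc_eq)
      moreover have "(\<Otimes>\<^bsub>V\<^esub>i\<in>crossings D \<inter> {..<n}. \<pi> (d i)) \<in> carrier V"
        using pi by (auto intro!: V.finprod_closed)
      ultimately show ?thesis
        using False e(4) hom_one[OF \<open>\<pi> \<in> hom P V\<close> P.group_axioms V.group_axioms] by simp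
    qed
    finally show "\<pi> (?a \<otimes>\<^bsub>P\<^esub> e) = (\<Otimes>\<^bsub>V\<^esub>i\<in>crossings D \<inter> {..<Suc n}. \<pi> (d i))" .
  qed
qed

text \<open>Line \<open>length D\<close> is empty, so its object is the unit, and all crossings lie
  above it.\<close>

lemma evaluation_props:
  assumes "comm_group V" "\<pi> \<in> hom P V"
    and "\<And>g e. g \<in> carrier H \<Longrightarrow> e \<in> carrier P \<Longrightarrow> \<pi> (act g e) = \<pi> e"
  shows "evaluation P H act D (c, d) \<in> kernel P H \<mu>"
    and "\<pi> (evaluation P H act D (c, d)) = (\<Otimes>\<^bsub>V\<^esub>i\<in>crossings D. \<pi> (d i))"
proof -
  obtain e where e: "e \<in> carrier P" "\<mu> e = line_obj (length D)"
    "foldl (mor_comp P) (mor_id P \<one>\<^bsub>H\<^esub>) (map (slice_mor P H act D (c, d)) [0..<length D]) =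
         (\<one>\<^bsub>H\<^esub>, e, line_obj (length D))"
    "\<pi> e = (\<Otimes>\<^bsub>V\<^esub>i\<in>crossings D \<inter> {..<length D}. \<pi> (d i))"
    using evaluation_prefix[OF assms, of "length D"] by auto
  moreover have "crossings D \<inter> {..<length D} = crossings D" by (auto simp: crossings_def)
  ultimately show "evaluation P H act D (c, d) \<in> kernel P H \<mu>"
    and "\<pi> (evaluation P H act D (c, d)) = (\<Otimes>\<^bsub>V\<^esub>i\<in>crossings D. \<pi> (d i))"
    by (auto simp: evaluation_def kernel_def line_dirs_def)
qed

end

section \<open>The Reidemeister pair of a rack cocycle\<close>

locale rack_cocycle_group = G: group G + V: comm_group V + rack "carrier G" rtri ltri
  for G :: "('a, 'm) monoid_scheme" and V :: "('v, 'n) monoid_scheme"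
    and rtri :: "'a \<Rightarrow> 'a \<Rightarrow> 'a" (infixl "\<triangleright>" 70) and ltri :: "'a \<Rightarrow> 'a \<Rightarrow> 'a" (infixl "\<triangleleft>" 70) +
  fixes w :: "'a \<Rightarrow> 'a \<Rightarrow> 'v"
  assumes cocycle: "rack_cocycle (carrier G) ltri V w"
begin

abbreviation "P \<equiv> G \<times>\<times> V"
abbreviation "\<psi> \<equiv> rack_psi G rtri w"
abbreviation "\<phi> \<equiv> rack_phi G V ltri w"

lemma w_closed: "x \<in> carrier G \<Longrightarrow> y \<in> carrier G \<Longrightarrow> w x y \<in> carrier V"
  using cocycle by (auto simp: rack_cocycle_def)

lemmas G_simps = G.m_assoc G.inv_mult_group G.mult_inv_cancel rtri_closed ltri_closed

text \<open>For the Peiffer identity, \<open>fst e\<close> acts on the \<open>G\<close>-component by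
  conjugation, while conjugation in the commutative \<open>V\<close> is trivial.\<close>

lemma crossed_module_conj: "crossed_module P G fst (conj_act G)"
proof -
  interpret P: group P by (rule DirProd_group) unfold_locales
  show ?thesis
  proof
    show "fst \<in> hom P G" by (auto simp: hom_def)
  next
    fix g assume "g \<in> carrier G"
    then show "conj_act G g \<in> hom P P" by (auto simp: hom_def conj_act_def G_simps)
  next
    fix e f assume "e \<in> carrier P" "f \<in> carrier P"
    then show "conj_act G (fst e) f = e \<otimes>\<^bsub>P\<^esub> f \<otimes>\<^bsub>P\<^esub> inv\<^bsub>P\<^esub> e"
      by (auto simp: conj_act_def G_simps V.m_comm V.mult_inv_cancel)
  qed (auto simp: conj_act_def G_simps)
qed

lemma kernel_fst: "kernel P G fst = {\<one>\<^bsub>G\<^esub>} \<times> carrier V"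
  by (auto simp: kernel_def)

lemma psi_closed: "\<psi> \<in> carrier G \<rightarrow> carrier G \<rightarrow> carrier P"
  by (auto simp: rack_psi_def w_closed rtri_closed)

lemma phi_closed: "\<phi> \<in> carrier G \<rightarrow> carrier G \<rightarrow> carrier P"
  by (auto simp: rack_phi_def w_closed ltri_closed)

lemma pos_under_eq:
  "X \<in> carrier G \<Longrightarrow> Y \<in> carrier G \<Longrightarrow> pos_under G fst \<psi> X Y = X \<triangleright> Y"
  by (simp add: pos_under_def rack_psi_def G_simps)

lemma neg_under_eq:
  "X \<in> carrier G \<Longrightarrow> Y \<in> carrier G \<Longrightarrow> neg_under G fst \<phi> X Y = Y \<triangleleft> X"
  by (simp add: neg_under_def rack_phi_def G_simps)

text \<open>Put \<open>Z = Y \<triangleleft> X\<close>, so \<open>X \<triangleright> Z = Y\<close>.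
  The \<open>G\<close>-components \<open>Y X Z^-1 X^-1\<close> and \<open>X Z X^-1 Y^-1\<close> are
  inverse, and both weights are \<open>w Y X\<close>, with opposite signs.\<close>

lemma reidemeister2: "reidemeister2 P G fst \<psi> \<phi>"
  by (simp add: reidemeister2_def neg_under_eq)
     (simp add: rack_psi_def rack_phi_def G_simps rtri_ltri w_closed)

text \<open>The \<open>G\<close>-components telescope to
  \<open>X Y T S^-1 (Y \<triangleleft> T)^-1 T^-1\<close>, where \<open>S\<close> is
  \<open>(X \<triangleleft> Y) \<triangleleft> T\<close> on the left and
  \<open>(X \<triangleleft> T) \<triangleleft> (Y \<triangleleft> T)\<close> on the right.\<close>

lemma reidemeister3: "reidemeister3 P G fst (conj_act G) \<phi>"
  unfolding reidemeister3_def Let_def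
proof (intro ballI)
  fix X Y T assume XYT: "X \<in> carrier G" "Y \<in> carrier G" "T \<in> carrier G"
  have w: "w X Y \<otimes>\<^bsub>V\<^esub> w (X \<triangleleft> Y) T = w X T \<otimes>\<^bsub>V\<^esub> w (X \<triangleleft> T) (Y \<triangleleft> T)"
    using cocycle XYT by (simp add: rack_cocycle_def)
  let ?i = "\<lambda>v. inv\<^bsub>V\<^esub> v"
  \<comment> \<open>The \<open>V\<close>-components are the inverted cocycle identity, with the
    weight of \<open>Y\<close> and \<open>T\<close> as a common extra factor.\<close>
  have "?i (w X Y) \<otimes>\<^bsub>V\<^esub> ?i (w (X \<triangleleft> Y) T) \<otimes>\<^bsub>V\<^esub> ?i (w Y T)
      = ?i (w Y T) \<otimes>\<^bsub>V\<^esub> ?i (w X Y \<otimes>\<^bsub>V\<^esub> w (X \<triangleleft> Y) T)"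
    using XYT by (simp add: V.inv_mult w_closed ltri_closed V.m_ac)
  also have "\<dots> = ?i (w Y T) \<otimes>\<^bsub>V\<^esub> ?i (w X T) \<otimes>\<^bsub>V\<^esub> ?i (w (X \<triangleleft> T) (Y \<triangleleft> T))"
    unfolding w using XYT by (simp add: V.inv_mult w_closed ltri_closed V.m_ac)
  finally show "\<phi> Y X \<otimes>\<^bsub>P\<^esub> conj_act G Y (\<phi> T (neg_under G fst \<phi> Y X)) \<otimes>\<^bsub>P\<^esub> \<phi> T Y =
    conj_act G X (\<phi> T Y) \<otimes>\<^bsub>P\<^esub> \<phi> T X \<otimes>\<^bsub>P\<^esub>
      conj_act G T (\<phi> (neg_under G fst \<phi> T Y) (neg_under G fst \<phi> T X))"
    using XYT ltri_distrib[OF XYT]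
    by (simp add: neg_under_eq) (simp add: rack_phi_def conj_act_def G_simps)
qed

text \<open>The left side cancels to \<open>Z A (Z \<triangleleft> A)^-1\<close>, which equals
  \<open>Z\<close> exactly when \<open>Z \<triangleleft> A = A\<close>.\<close>

lemma framing_equation:
  assumes "A \<in> carrier G" "Z \<in> carrier G"
  shows "fst (\<phi> A Z) \<otimes>\<^bsub>G\<^esub> A = Z \<longleftrightarrow> A = Z \<triangleleft> Z"
proof -
  have "fst (\<phi> A Z) \<otimes>\<^bsub>G\<^esub> A = Z \<otimes>\<^bsub>G\<^esub> (A \<otimes>\<^bsub>G\<^esub> inv\<^bsub>G\<^esub> (Z \<triangleleft> A))"
    using assms by (simp add: rack_phi_def G_simps)
  also have "\<dots> = Z \<longleftrightarrow> A \<otimes>\<^bsub>G\<^esub> inv\<^bsub>G\<^esub> (Z \<triangleleft> A) = \<one>\<^bsub>G\<^esub>"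
    using assms ltri_closed by simp
  also have "\<dots> \<longleftrightarrow> Z \<triangleleft> A = A"
    using assms ltri_closed by (metis G.inv_closed G.inv_equality G.inv_inv G.r_inv)
  finally show ?thesis using ltri_eq_self_iff[OF assms] by simp
qed

lemma framed_pair: "framed_reidemeister_pair P G fst (conj_act G) \<psi> \<phi>"
proof -
  define f where "f = (\<lambda>Z. THE A. A \<in> carrier G \<and> fst (\<phi> A Z) \<otimes>\<^bsub>G\<^esub> A = Z)"
  define g where "g = (\<lambda>A. inv\<^bsub>G\<^esub> (fst (\<psi> A A)) \<otimes>\<^bsub>G\<^esub> A)"
  \<comment> \<open>Describes the whole solution set, which gives unique existence and the value of
    \<open>THE\<close> at once.\<close>
  have sol: "A \<in> carrier G \<and> fst (\<phi> A Z) \<otimes>\<^bsub>G\<^esub> A = Z \<longleftrightarrow> A = Z \<triangleleft> Z" if "Z \<in> carrier G" for A Z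
    using that framing_equation ltri_closed by metis
  have f: "f Z = Z \<triangleleft> Z" if "Z \<in> carrier G" for Z
    unfolding f_def sol[OF that] by simp
  have g: "g A = A \<triangleright> A" if "A \<in> carrier G" for A
    using that by (simp add: g_def rack_psi_def G_simps)
  have "\<forall>Z\<in>carrier G. \<exists>!A. A \<in> carrier G \<and> fst (\<phi> A Z) \<otimes>\<^bsub>G\<^esub> A = Z"
    using sol by simp
  moreover have "\<forall>A\<in>carrier G. f (g A) = A" "\<forall>Z\<in>carrier G. g (f Z) = Z"
    by (simp_all add: f g rtri_closed ltri_closed ltri_self_rtri_self rtri_self_ltri_self)
  ultimately show ?thesis
    unfolding framed_reidemeister_pair_def f_def g_def Let_def
    using psi_closed phi_closed reidemeister2 reidemeister3 by blast
qed

text \<open>Idempotency makes the \<open>G\<close>-component of \<open>\<psi> X X\<close> cancel and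
  its weight \<open>w X X\<close>, which is trivial for a quandle cocycle.\<close>

lemma unframed_pair:
  assumes "quandle (carrier G) rtri ltri" "quandle_cocycle (carrier G) ltri V w"
  shows "unframed_reidemeister_pair P G fst (conj_act G) \<psi> \<phi>"
proof -
  have "reidemeister1 P G \<psi>"
    using assms
    by (auto simp: reidemeister1_def rack_psi_def quandle_cocycle_def quandle.rtri_idem G_simps)
  then show ?thesis
    unfolding unframed_reidemeister_pair_def
    using psi_closed phi_closed reidemeister2 reidemeister3 by blast
qed

section \<open>Comparison of the colourings and of the two invariants\<close>

text \<open>Restricted to the crossings, so that it is extensional and can equal the second part of
  a Reidemeister colouring.\<close>

definition crossing_colour :: "slice list \<Rightarrow> ((nat \<times> nat) set \<Rightarrow> 'a) \<Rightarrow> nat \<Rightarrow> 'a \<times> 'v" where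
  "crossing_colour D c = (\<lambda>i\<in>crossings D.
     (if piece_of (D ! i) = PosX then \<psi> else \<phi>) (c (over_arc D i)) (c (lower_under_arc D i)))"

text \<open>The arc colours determine the crossing colours, and \<open>pos_under_eq\<close> and
  \<open>neg_under_eq\<close> turn the crossing conditions into the rack ones.\<close>

lemma reidemeister_colourings_eq:
  assumes "link_diagram D"
  shows "reidemeister_colourings P G fst \<psi> \<phi> D =
    (\<lambda>c. (c, crossing_colour D c)) ` rack_colourings (carrier G) rtri ltri D" (is "?L = ?f ` ?C")
proof -
  have "(c, d) \<in> ?L \<longleftrightarrow> c \<in> ?C \<and> d = crossing_colour D c" for c d
  proof (cases "c \<in> arcs D \<rightarrow>\<^sub>E carrier G")
    case True
    then have carr: "c (over_arc D i) \<in> carrier G" "c (lower_under_arc D i) \<in> carrier G"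
      if "i \<in> crossings D" for i
      using crossing_arcs_in_arcs[OF assms that] by auto
    have kind: "piece_of (D ! i) = PosX \<or> piece_of (D ! i) = NegX" if "i \<in> crossings D" for i
      using that by (auto simp: crossings_def)
    have cc: "crossing_colour D c \<in> crossings D \<rightarrow>\<^sub>E carrier P"
      unfolding crossing_colour_def using carr psi_closed phi_closed
      by (auto simp: Pi_iff simp del: carrier_DirProd)
    have eq: "d = crossing_colour D c \<longleftrightarrow> d \<in> crossings D \<rightarrow>\<^sub>E carrier P \<and>
        (\<forall>i\<in>crossings D. d i = crossing_colour D c i)"
      using cc by (metis PiE_ext)
    have "(c, d) \<in> ?L \<longleftrightarrow> d \<in> crossings D \<rightarrow>\<^sub>E carrier P \<and> (\<forall>i\<in>crossings D.
        let y = c (over_arc D i); x = c (lower_under_arc D i); z = c (upper_under_arc D i)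
        in (piece_of (D ! i) = PosX \<longrightarrow> d i = \<psi> y x \<and> z = y \<triangleright> x) \<and>
           (piece_of (D ! i) = NegX \<longrightarrow> d i = \<phi> y x \<and> z = x \<triangleleft> y))"
      using True carr
      by (simp add: reidemeister_colourings_def Let_def pos_under_eq neg_under_eq
          del: carrier_DirProd)
    also have "\<dots> \<longleftrightarrow> c \<in> ?C \<and> d = crossing_colour D c"
      unfolding eq using True kind
      by (fastforce simp: rack_colourings_def Let_def crossing_colour_def)
    finally show ?thesis .
  qed (auto simp: reidemeister_colourings_def rack_colourings_def)
  then show ?thesis by auto
qed

text \<open>Membership in the kernel of \<open>fst\<close> gives the first component;
  \<open>snd\<close>, which \<open>conj_act\<close> preserves, is the \<open>\<pi>\<close> that
  gives the second.\<close>

lemma evaluation_eq: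
  assumes "link_diagram D" and c: "c \<in> rack_colourings (carrier G) rtri ltri D"
  shows "evaluation P G (conj_act G) D (c, crossing_colour D c) =
    (\<one>\<^bsub>G\<^esub>, \<Otimes>\<^bsub>V\<^esub>i\<in>crossings D. crossing_weight rtri w D c i [^]\<^bsub>V\<^esub> crossing_sign D i)"
proof -
  interpret C: crossed_module P G fst "conj_act G" by (rule crossed_module_conj)
  interpret L: coloured_link P G fst "conj_act G" \<psi> \<phi> D c "crossing_colour D c"
    using assms by unfold_locales (auto simp: reidemeister_colourings_eq)
  let ?e = "evaluation P G (conj_act G) D (c, crossing_colour D c)"
  have "snd \<in> hom P V" by (auto simp: hom_def)
  note ev = L.evaluation_props[OF V.comm_group_axioms this]
  \<comment> \<open>At a negative crossing the inverse in \<open>\<phi>\<close> is the power with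
    exponent -1. Carrier membership is kept for \<open>finprod_cong'\<close>.\<close>
  have "snd (crossing_colour D c i) = crossing_weight rtri w D c i [^]\<^bsub>V\<^esub> crossing_sign D i \<and>
      crossing_weight rtri w D c i [^]\<^bsub>V\<^esub> crossing_sign D i \<in> carrier V"
    if i: "i \<in> crossings D" for i
  proof -
    have "c (over_arc D i) \<in> carrier G" "c (lower_under_arc D i) \<in> carrier G"
      using crossing_arcs_in_arcs[OF assms(1) i] by (auto intro: L.arc_colour_closed)
    then show ?thesis using i
      by (auto simp: crossing_colour_def crossing_weight_def crossing_sign_def rack_psi_def
          rack_phi_def Let_def w_closed rtri_closed V.int_pow_neg V.int_pow_1)
  qed
  then have "(\<Otimes>\<^bsub>V\<^esub>i\<in>crossings D. snd (crossing_colour D c i)) =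
      (\<Otimes>\<^bsub>V\<^esub>i\<in>crossings D. crossing_weight rtri w D c i [^]\<^bsub>V\<^esub> crossing_sign D i)"
    by (intro V.finprod_cong') (auto simp: Pi_iff)
  then show ?thesis
    using ev by (auto simp: conj_act_def kernel_def prod_eq_iff)
qed

text \<open>\<open>frag_extend\<close> carries the isomorphism of \<open>V\<close> with
  \<open>{\<one>} \<times> V\<close> to the group rings. It is additive, so the sums over colourings
  match term by term.\<close>

lemma invariant_eq:
  assumes "link_diagram D" "finite (carrier G)"
  shows "reidemeister_invariant P G fst (conj_act G) \<psi> \<phi> D =
    frag_extend (\<lambda>v. frag_of (\<one>\<^bsub>G\<^esub>, v)) (cocycle_invariant (carrier G) rtri ltri V w D)"
proof -
  let ?C = "rack_colourings (carrier G) rtri ltri D"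
  \<comment> \<open>Distinct rack colourings yield distinct pairs, so reindexing merges no
    summands.\<close>
  have "inj_on (\<lambda>c. (c, crossing_colour D c)) ?C" by (auto simp: inj_on_def)
  then have "reidemeister_invariant P G fst (conj_act G) \<psi> \<phi> D =
      (\<Sum>c\<in>?C. frag_of (evaluation P G (conj_act G) D (c, crossing_colour D c)))"
    by (simp add: reidemeister_invariant_def reidemeister_colourings_eq[OF assms(1)]
        sum.reindex o_def)
  also have "\<dots> = (\<Sum>c\<in>?C. frag_extend (\<lambda>v. frag_of (\<one>\<^bsub>G\<^esub>, v))
      (frag_of (\<Otimes>\<^bsub>V\<^esub>i\<in>crossings D. crossing_weight rtri w D c i [^]\<^bsub>V\<^esub> crossing_sign D i)))"
    using evaluation_eq[OF assms(1)] by (intro sum.cong) simp_all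
  also have "\<dots> = frag_extend (\<lambda>v. frag_of (\<one>\<^bsub>G\<^esub>, v)) (cocycle_invariant (carrier G) rtri ltri V w D)"
    unfolding cocycle_invariant_def
    by (subst frag_extend_sum) (simp_all add: finite_rack_colourings assms(2) o_def)
  finally show ?thesis .
qed

text \<open>Every summand is a basis element from the kernel, and the keys of a sum lie in the union
  of the keys of its terms.\<close>

lemma invariant_in_kernel_ring:
  assumes "link_diagram D"
  shows "reidemeister_invariant P G fst (conj_act G) \<psi> \<phi> D
    \<in> carrier (free_Abelian_group (kernel P G fst))"
proof -
  interpret C: crossed_module P G fst "conj_act G" by (rule crossed_module_conj)
  have "evaluation P G (conj_act G) D F \<in> kernel P G fst"
    if "F \<in> reidemeister_colourings P G fst \<psi> \<phi> D" for F
  proof -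
    interpret L: coloured_link P G fst "conj_act G" \<psi> \<phi> D "fst F" "snd F"
      using assms that by unfold_locales auto
    have "snd \<in> hom P V" by (auto simp: hom_def)
    from L.evaluation_props(1)[OF V.comm_group_axioms this] show ?thesis
      by (simp add: conj_act_def)
  qed
  then show ?thesis
    unfolding reidemeister_invariant_def carrier_free_Abelian_group_iff
    by (intro order.trans[OF keys_sum]) auto
qed

end

theorem theorem4p6:
  fixes R :: "'a set"
    and rtri ltri :: "'a \<Rightarrow> 'a \<Rightarrow> 'a"
    and V :: "('v, 'n) monoid_scheme"
    and w :: "'a \<Rightarrow> 'a \<Rightarrow> 'v"
    and G :: "('a, 'm) monoid_scheme"
  assumes "rack R rtri ltri" and "finite R"
    and "comm_group V" and "rack_cocycle R ltri V w"
    and "group G" and "carrier G = R"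
  shows
    "let P = G \<times>\<times> V; \<psi> = rack_psi G rtri w; \<phi> = rack_phi G V ltri w;
         I = reidemeister_invariant P G fst (conj_act G) \<psi> \<phi>;
         \<iota> = frag_extend (\<lambda>v. frag_of (\<one>\<^bsub>G\<^esub>, v))
     in crossed_module P G fst (conj_act G) \<and>
        kernel P G fst = {\<one>\<^bsub>G\<^esub>} \<times> carrier V \<and>
        framed_reidemeister_pair P G fst (conj_act G) \<psi> \<phi> \<and>
        (\<forall>D. link_diagram D \<longrightarrow>
           I D \<in> carrier (free_Abelian_group (kernel P G fst)) \<and>
           I D = \<iota> (cocycle_invariant R rtri ltri V w D)) \<and>
        (quandle R rtri ltri \<and> quandle_cocycle R ltri V w \<longrightarrow>
           unframed_reidemeister_pair P G fst (conj_act G) \<psi> \<phi> \<and>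
           (\<forall>D. link_diagram D \<longrightarrow> I D = \<iota> (cocycle_invariant R rtri ltri V w D)))"
proof -
  interpret rack_cocycle_group G V rtri ltri w
    using assms by (simp add: rack_cocycle_group_def rack_cocycle_group_axioms_def)
  \<comment> \<open>For a quandle, colourings and weights are unchanged, so the equality of
    invariants carries over; what is added is R1.\<close>
  show ?thesis
    unfolding Let_def
    using assms(2,6) crossed_module_conj kernel_fst framed_pair unframed_pair
      invariant_in_kernel_ring invariant_eq
    by auto
qed

end
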